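(* The monoid $(\mathrm{PT},\cdot,(-)^*,\bar\epsilon)$ is an $E$-unitary inverse monoid.
   Context: A tree is a nonempty prefix-closed finitely branching set $A\subseteq(\mathbb N^+)^*$ with $wj\in A$, $i<j$ implying $wi\in A$. A permutation tree is a map $t:A\to\mathrm{Sym}(\mathbb N^+)$ (possibly infinite) such that a node with exactly $n$ children has label in $S_n$ (permutations of $\mathbb N^+$ fixing all $i>n$). Write $t=\langle\pi;t_1,..,t_n\rangle$ (root label $\pi$, subtrees $t_i$); $\bar\epsilon$ is the one-node tree. $\mathrm{PT}$ is the set of permutation trees. Product (coinductive): $t\bar\epsilon=t=\bar\epsilon t$; for $t=\langle\pi;t_1..t_n\rangle$, $u=\langle\rho;u_1..u_m\rangle$: if $n\ge m$, $tu=\langle\pi\circ\rho;u_1t_{\rho1},..,u_mt_{\rho m},t_{m+1},..,t_n\rangle$; if $m\ge n$, $tu=\langle\pi\circ\rho;u_1t_{\rho1},..,u_mt_{\rho m}\rangle$ with $t_j:=\bar\epsilon$ for $j>n$. $\bar\epsilon^*=\bar\epsilon$, $t^*=\langle\pi^{-1};(t_{\pi^{-1}1})^*,..,(t_{\pi^{-1}n})^*\rangle$. An inverse monoid is a monoid with unary $^*$ satisfying $(u^* )^*=u$, $(uv)^*=v^*u^*$, $uu^*u=u$, $uu^*vv^*=vv^*uu^*$; natural order $u\le v$ iff $uu^*v=u$; it is $E$-unitary if whenever $e$ is idempotent and $e\le v$ then $v$ is idempotent. *)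

theory Defs
  imports
    "HOL-Algebra.Group"
    "HOL-Combinatorics.Permutations"
    "HOL-Library.Sublist"
begin

section \<open>E-unitary inverse monoids\<close>

locale inverse_monoid = monoid G for G (structure) +
  fixes star :: "'a \<Rightarrow> 'a"
  assumes star_closed: "u \<in> carrier G \<Longrightarrow> star u \<in> carrier G"
    and star_star: "u \<in> carrier G \<Longrightarrow> star (star u) = u"
    and star_mult: "\<lbrakk>u \<in> carrier G; v \<in> carrier G\<rbrakk>
          \<Longrightarrow> star (u \<otimes> v) = star v \<otimes> star u"
    and mult_star_mult: "u \<in> carrier G \<Longrightarrow> u \<otimes> star u \<otimes> u = u"
    and mult_star_commute: "\<lbrakk>u \<in> carrier G; v \<in> carrier G\<rbrakk>
          \<Longrightarrow> (u \<otimes> star u) \<otimes> (v \<otimes> star v) = (v \<otimes> star v) \<otimes> (u \<otimes> star u)"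
begin

definition idempotent :: "'a \<Rightarrow> bool" where
  "idempotent e \<longleftrightarrow> e \<otimes> e = e"

definition natural_le :: "'a \<Rightarrow> 'a \<Rightarrow> bool" where
  "natural_le u v \<longleftrightarrow> u \<otimes> star u \<otimes> v = u"

end

locale E_unitary_inverse_monoid = inverse_monoid +
  assumes E_unitary: "\<lbrakk>e \<in> carrier G; v \<in> carrier G; idempotent e; natural_le e v\<rbrakk>
    \<Longrightarrow> idempotent v"


section \<open>Permutation trees\<close>

text \<open>
  Words over the positive integers are lists of positive naturals, and a permutation
  of the positive integers is a function on \<^typ>\<open>nat\<close> that also fixes \<open>0\<close>, so that
  \<open>Sym\<close> of the positive integers is \<open>{p. p permutes {1..}}\<close> and \<open>S\<^sub>n\<close> is
  \<open>{p. p permutes {1..n}}\<close>.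
\<close>

definition is_tree :: "nat list set \<Rightarrow> bool" where
  "is_tree A \<longleftrightarrow>
     A \<subseteq> lists {1..} \<and>
     A \<noteq> {} \<and>
     (\<forall>w\<in>A. \<forall>v. prefix v w \<longrightarrow> v \<in> A) \<and>
     (\<forall>w\<in>A. finite {i. w @ [i] \<in> A}) \<and>
     (\<forall>w j i. w @ [j] \<in> A \<and> 1 \<le> i \<and> i < j \<longrightarrow> w @ [i] \<in> A)"

text \<open>A map defined on a tree \<open>A\<close> is a partial function on all words with domain \<open>A\<close>.\<close>

type_synonym ptree = "nat list \<rightharpoonup> (nat \<Rightarrow> nat)"

definition PT :: "ptree set" where
  "PT = {t. is_tree (dom t) \<and>
            (\<forall>w\<in>dom t. the (t w) permutes {1..} \<and>
                        the (t w) permutes {1..card {i. w @ [i] \<in> dom t}})}"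

definition pt_one :: ptree where
  "pt_one = [[] \<mapsto> id]"

definition root :: "ptree \<Rightarrow> nat \<Rightarrow> nat" where
  "root t = the (t [])"

definition arity :: "ptree \<Rightarrow> nat" where
  "arity t = card {i. [i] \<in> dom t}"

text \<open>The \<open>j\<close>-th immediate subtree, with the convention that it is the one-node tree
  when \<open>j\<close> exceeds the number of children.\<close>

definition child :: "ptree \<Rightarrow> nat \<Rightarrow> ptree" where
  "child t j = (if [j] \<in> dom t then (\<lambda>w. t (j # w)) else pt_one)"

text \<open>The tree \<open>\<langle>p; t\<^sub>1, \<dots>, t\<^sub>n\<rangle>\<close> for \<open>ts = [t\<^sub>1, \<dots>, t\<^sub>n]\<close>.\<close>

fun pt_node :: "(nat \<Rightarrow> nat) \<Rightarrow> ptree list \<Rightarrow> ptree" where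
  "pt_node p ts [] = Some p"
| "pt_node p ts (i # w) = (if i \<in> {1..length ts} then (ts ! (i - 1)) w else None)"

text \<open>
  A tree defined by corecursion is given here by its value at each address; unfolding the
  corecursive equation once consumes the first letter of the address. The equations in their
  corecursive form are the lemmas \<open>pt_mult_one_right\<close> to \<open>pt_star_node\<close> below.
\<close>

fun pt_mult :: "ptree \<Rightarrow> ptree \<Rightarrow> ptree" where
  "pt_mult t u [] =
     (if u = pt_one then t []
      else if t = pt_one then u []
      else Some (root t \<circ> root u))"
| "pt_mult t u (i # w) =
     (if u = pt_one then t (i # w)
      else if t = pt_one then u (i # w)
      else if i \<in> {1..arity u} then pt_mult (child u i) (child t (root u i)) w
      else if i \<in> {1..arity t} then child t i w
      else None)"

text \<open>\<open>inv_into UNIV\<close> is the inverse of a function; plain \<open>inv\<close> clashes with the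
  inverse in a group.\<close>

fun pt_star :: "ptree \<Rightarrow> ptree" where
  "pt_star t [] = Some (inv_into UNIV (root t))"
| "pt_star t (i # w) =
     (if i \<in> {1..arity t} then pt_star (child t (inv_into UNIV (root t) i)) w else None)"

definition PT_monoid :: "ptree monoid" where
  "PT_monoid = \<lparr>carrier = PT, monoid.mult = pt_mult, one = pt_one\<rparr>"


subsection \<open>The corecursive equations\<close>

lemma pt_node_eta:
  assumes "t \<in> PT"
  shows "t = pt_node (root t) (map (child t) [1..<Suc (arity t)])"
proof
  fix w
  have tr: "is_tree (dom t)" using assms by (simp add: PT_def)
  have pre: "\<And>v w. w \<in> dom t \<Longrightarrow> prefix v w \<Longrightarrow> v \<in> dom t"
    using tr unfolding is_tree_def by blast
  obtain w0 where "w0 \<in> dom t" using tr unfolding is_tree_def by blast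
  hence nil: "[] \<in> dom t" using pre Nil_prefix by blast
  let ?K = "{i. [i] \<in> dom t}"
  have "finite {i. [] @ [i] \<in> dom t}" using tr nil unfolding is_tree_def by blast
  hence fin: "finite ?K" by simp
  have pos: "1 \<le> i" if "i \<in> ?K" for i
  proof -
    have "[i] \<in> lists {1..}" using tr that unfolding is_tree_def by blast
    thus ?thesis by simp
  qed
  have down: "\<And>i j. j \<in> ?K \<Longrightarrow> 1 \<le> i \<Longrightarrow> i < j \<Longrightarrow> i \<in> ?K"
  proof -
    fix i j assume "j \<in> ?K" "1 \<le> i" "i < j"
    hence "[] @ [j] \<in> dom t \<and> 1 \<le> i \<and> i < j" by simp
    hence "[] @ [i] \<in> dom t" using tr unfolding is_tree_def by blast
    thus "i \<in> ?K" by simp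
  qed
  have K: "?K = {1..arity t}"
  proof (cases "?K = {}")
    case True thus ?thesis unfolding arity_def by simp
  next
    case False
    have "?K = {1..Max ?K}"
    proof
      show "?K \<subseteq> {1..Max ?K}"
      proof
        fix i assume "i \<in> ?K"
        thus "i \<in> {1..Max ?K}" using pos Max_ge[OF fin] unfolding atLeastAtMost_iff by blast
      qed
      show "{1..Max ?K} \<subseteq> ?K"
      proof
        fix i assume i: "i \<in> {1..Max ?K}"
        have M: "Max ?K \<in> ?K" using fin False by (rule Max_in)
        show "i \<in> ?K"
        proof (cases "i = Max ?K")
          case True thus ?thesis using M by (rule ssubst)
        next
          case False
          have "1 \<le> i" "i < Max ?K" using i False by auto
          thus ?thesis using down[OF M] by blast
        qed
      qed
    qed
    then obtain M where M: "?K = {1..M}" by blast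
    hence "arity t = M" unfolding arity_def by simp
    thus ?thesis using M by simp
  qed
  show "t w = pt_node (root t) (map (child t) [1..<Suc (arity t)]) w"
  proof (cases w)
    case Nil
    thus ?thesis using nil by (auto simp: root_def)
  next
    case (Cons i v)
    show ?thesis
    proof (cases "i \<in> {1..arity t}")
      case True
      hence "[i] \<in> dom t" using K by blast
      hence "child t i v = t (i # v)" by (simp add: child_def)
      thus ?thesis using True Cons by (auto simp del: upt_Suc)
    next
      case False
      hence "[i] \<notin> dom t" using K by blast
      hence "t (i # v) = None" using pre[of "i # v" "[i]"] by auto
      thus ?thesis using False Cons by (auto simp del: upt_Suc)
    qed
  qed
qed

lemma pt_mult_one_right: "pt_mult t pt_one = t"
proof
  show "pt_mult t pt_one w = t w" for w by (cases w) auto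
qed

lemma pt_mult_one_left: "pt_mult pt_one t = t"
proof
  show "pt_mult pt_one t w = t w" for w by (cases w) auto
qed

lemma pt_mult_node_ge:
  assumes "t \<noteq> pt_one" "u \<noteq> pt_one" "arity t \<ge> arity u"
  shows "pt_mult t u = pt_node (root t \<circ> root u)
    (map (\<lambda>i. pt_mult (child u i) (child t (root u i))) [1..<Suc (arity u)] @
     map (child t) [Suc (arity u)..<Suc (arity t)])"
proof
  show "pt_mult t u w = pt_node (root t \<circ> root u)
    (map (\<lambda>i. pt_mult (child u i) (child t (root u i))) [1..<Suc (arity u)] @
     map (child t) [Suc (arity u)..<Suc (arity t)]) w" for w
    using assms by (cases w) (auto simp: nth_append simp del: upt_Suc)
qed

lemma pt_mult_node_le:
  assumes "t \<noteq> pt_one" "u \<noteq> pt_one" "arity u \<ge> arity t"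
  shows "pt_mult t u = pt_node (root t \<circ> root u)
    (map (\<lambda>i. pt_mult (child u i) (child t (root u i))) [1..<Suc (arity u)])"
proof
  show "pt_mult t u w = pt_node (root t \<circ> root u)
    (map (\<lambda>i. pt_mult (child u i) (child t (root u i))) [1..<Suc (arity u)]) w" for w
    using assms by (cases w) (auto simp del: upt_Suc)
qed

lemma pt_star_one: "pt_star pt_one = pt_one"
proof
  show "pt_star pt_one w = pt_one w" for w
    by (cases w) (auto simp: pt_one_def root_def arity_def)
qed

lemma pt_star_node:
  "pt_star t = pt_node (inv_into UNIV (root t))
     (map (\<lambda>i. pt_star (child t (inv_into UNIV (root t) i))) [1..<Suc (arity t)])"
proof
  show "pt_star t w = pt_node (inv_into UNIV (root t))
     (map (\<lambda>i. pt_star (child t (inv_into UNIV (root t) i))) [1..<Suc (arity t)]) w" for w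
    by (cases w) (auto simp del: upt_Suc)
qed

end

theory Submission imports Defs begin

text \<open>
  A permutation tree is determined by its root, its arity and its children, where \<open>child t i\<close>
  makes sense for every \<open>i\<close> because missing children are read as one-node trees. With this
  convention the case distinctions of the product disappear:
  \<open>root (t u) = root t \<circ> root u\<close>, \<open>arity (t u) = max (arity t) (arity u)\<close> and
  \<open>(t u)\<^sub>i = u\<^sub>i t\<^bsub>root u i\<^esub>\<close>, while
  \<open>(t\<^sup>*)\<^sub>i = (t\<^bsub>j\<^esub>)\<^sup>*\<close> for \<open>j\<close> the preimage of \<open>i\<close> under the root. Every law
  then follows by bisimulation. Since the children are multiplied in the opposite order,
  a law and its mirror image have to be part of the same bisimulation; this matters for
  E-unitarity, where \<open>e v = e\<close> and \<open>v e = e\<close> alternate along the levels.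
\<close>

section \<open>Coinduction for permutation trees\<close>

text \<open>\<open>PT\<close> is treated as a greatest fixed point: by induction on addresses,
  \<open>P\<close> reaches the subtree at every node, so the local condition holds everywhere.
  Subtrees appear as \<open>\<lambda>w. t (i # w)\<close> and not as \<open>child t i\<close>, which
  would turn an absent subtree into \<open>pt_one\<close>.\<close>

lemma PT_coinduct [consumes 1, case_names step]:
  assumes "P t"
    and step: "\<And>t. P t \<Longrightarrow> t [] \<noteq> None \<and> (\<exists>n. root t permutes {1..n} \<and>
      (\<forall>i. if i \<in> {1..n} then P (\<lambda>w. t (i # w)) else \<forall>w. t (i # w) = None))"
  shows "t \<in> PT"
proof -
  have Some_ConsD: "1 \<le> i \<and> P (\<lambda>w. t (i # w))"
    if Pt: "P t" and Some: "t (i # w) = Some p" for t i w p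
  proof -
    obtain n where n: "if i \<in> {1..n} then P (\<lambda>w. t (i # w)) else \<forall>w. t (i # w) = None"
      using step[OF Pt] by blast
    show ?thesis
    proof (cases "i \<in> {1..n}")
      case False
      with n have "t (i # w) = None" by simp
      with Some show ?thesis by simp
    qed (use n in simp)
  qed
  have subtree: "P (\<lambda>v. t (w @ v))" if "P t" "t w = Some p" for w t p
    using that
  proof (induction w arbitrary: t)
    case (Cons i w)
    then show ?case using Cons.IH[of "\<lambda>w. t (i # w)"] Some_ConsD by simp
  qed simp
  have lists: "w \<in> lists {1..}" if "P t" "t w = Some p" for w t p
    using that
  proof (induction w arbitrary: t)
    case (Cons i w)
    then show ?case using Cons.IH[of "\<lambda>w. t (i # w)"] Some_ConsD[of t i w p] by simp
  qed simp
  have pre: "w \<in> dom t" if "P t" "t (w @ v) = Some p" for w v t p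
    using that
  proof (induction w arbitrary: t)
    case Nil
    then show ?case using step[of t] by (simp add: domIff)
  next
    case (Cons i w)
    then show ?case using Cons.IH[of "\<lambda>w. t (i # w)"] Some_ConsD[of t i "w @ v" p]
      by (simp add: domIff)
  qed
  have sub: "\<exists>n. {i. w @ [i] \<in> dom t} = {1..n} \<and> the (t w) permutes {1..n}"
    if w: "w \<in> dom t" for w
  proof -
    \<comment> \<open>\<open>?s\<close> is the subtree at \<open>w\<close>; it inherits
      \<open>P\<close>, so \<open>step\<close> treats the node \<open>w\<close> as a root.\<close>
    let ?s = "\<lambda>v. t (w @ v)"
    obtain n where n: "root ?s permutes {1..n}"
      "\<And>i. if i \<in> {1..n} then P (\<lambda>v. ?s (i # v)) else \<forall>v. ?s (i # v) = None"
      using step[of ?s] subtree[OF \<open>P t\<close>] w by blast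
    have "w @ [i] \<in> dom t \<longleftrightarrow> i \<in> {1..n}" for i
    proof (cases "i \<in> {1..n}")
      case True
      then have "P (\<lambda>v. ?s (i # v))" using n(2)[of i] by simp
      from step[OF this] True show ?thesis by (simp add: domIff)
    next
      case False
      then show ?thesis using n(2)[of i] by (simp add: domIff)
    qed
    then have "{i. w @ [i] \<in> dom t} = {1..n}" by blast
    moreover have "the (t w) permutes {1..n}" using n(1) by (simp add: root_def)
    ultimately show ?thesis by blast
  qed
  have "is_tree (dom t)"
    unfolding is_tree_def
  proof (intro conjI ballI allI impI)
    show "dom t \<subseteq> lists {1..}" using lists \<open>P t\<close> by blast
    show "dom t \<noteq> {}" using step[OF \<open>P t\<close>] by blast
    show "v \<in> dom t" if "w \<in> dom t" "prefix v w" for w v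
      using that pre[OF \<open>P t\<close>] by (auto simp: prefix_def)
    show "finite {i. w @ [i] \<in> dom t}" if "w \<in> dom t" for w
      using sub[OF that] by auto
    show "w @ [i] \<in> dom t" if a: "w @ [j] \<in> dom t \<and> 1 \<le> i \<and> i < j" for w j i
    proof -
      obtain n where n: "{i. w @ [i] \<in> dom t} = {1..n}"
        using a sub[of w] pre[OF \<open>P t\<close>] by blast
      have "j \<in> {1..n}" using a n by blast
      then have "i \<in> {1..n}" using a by auto
      then show ?thesis using n by blast
    qed
  qed
  moreover have "the (t w) permutes {1..}"
    "the (t w) permutes {1..card {i. w @ [i] \<in> dom t}}" if "w \<in> dom t" for w
    using sub[OF that] by (auto intro: permutes_subset)
  ultimately show ?thesis by (auto simp: PT_def)
qed

section \<open>Root, arity and children of a permutation tree\<close>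

lemma
  assumes "t \<in> PT"
  shows PT_root_Some: "t [] = Some (root t)"
    and PT_Cons: "t (i # w) = (if i \<in> {1..arity t} then child t i w else None)"
  using fun_cong[OF pt_node_eta[OF assms], of "[]"] fun_cong[OF pt_node_eta[OF assms], of "i # w"]
  by (auto simp del: upt_Suc)

lemma PT_root_permutes:
  assumes "t \<in> PT"
  shows "root t permutes {1..arity t}"
proof -
  have "[] \<in> dom t" using PT_root_Some[OF assms] by blast
  then have "the (t []) permutes {1..card {i. [] @ [i] \<in> dom t}}"
    using assms unfolding PT_def by blast
  then show ?thesis by (simp add: root_def arity_def)
qed

lemma child_pt_one [simp]: "child pt_one i = pt_one"
  by (simp add: child_def pt_one_def)

lemma root_pt_one [simp]: "root pt_one = id"
  by (simp add: root_def pt_one_def)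

lemma arity_pt_one [simp]: "arity pt_one = 0"
  by (simp add: arity_def pt_one_def)

lemma pt_one_in_PT [simp]: "pt_one \<in> PT"
proof -
  \<comment> \<open>The invariant is equality with \<open>pt_one\<close>; the bound \<open>0\<close>
    leaves no subtree to check.\<close>
  have "pt_one = t \<Longrightarrow> t \<in> PT" for t
  proof (coinduction arbitrary: t rule: PT_coinduct)
    case (step t)
    show ?case
      unfolding step[symmetric]
      by (intro conjI exI[of _ 0]) (auto simp: pt_one_def root_def permutes_id[unfolded id_def])
  qed
  then show ?thesis by simp
qed

lemma in_dom_iff_arity:
  assumes "t \<in> PT"
  shows "[i] \<in> dom t \<longleftrightarrow> i \<in> {1..arity t}"
proof -
  \<comment> \<open>If \<open>[i]\<close> were missing for some \<open>i\<close> within the arity,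
    \<open>child t i\<close> would be the default \<open>pt_one\<close>, whose root is defined, and
    \<open>PT_Cons\<close> would put \<open>[i]\<close> into the domain after all.\<close>
  have "pt_one [] \<noteq> None" by (simp add: pt_one_def)
  then show ?thesis
    using PT_Cons[OF assms, of i "[]"] by (auto simp: child_def split: if_splits)
qed

lemma child_in_PT [simp]:
  assumes "t \<in> PT"
  shows "child t i \<in> PT"
proof (cases "[i] \<in> dom t")
  case True
  have tree: "is_tree (dom t)" and perm: "\<And>w. w \<in> dom t \<Longrightarrow> the (t w) permutes {1..} \<and>
      the (t w) permutes {1..card {i. w @ [i] \<in> dom t}}"
    using assms by (auto simp: PT_def)
  have "is_tree {w. i # w \<in> dom t}"
    unfolding is_tree_def
  proof (intro conjI ballI allI impI)
    show "{w. i # w \<in> dom t} \<subseteq> lists {1..}" using tree unfolding is_tree_def by fastforce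
    show "{w. i # w \<in> dom t} \<noteq> {}" using True by blast
    show "v \<in> {w. i # w \<in> dom t}" if "w \<in> {w. i # w \<in> dom t}" "prefix v w" for w v
      using that tree unfolding is_tree_def by (metis Cons_prefix_Cons mem_Collect_eq)
    show "finite {j. w @ [j] \<in> {w. i # w \<in> dom t}}" if "w \<in> {w. i # w \<in> dom t}" for w
    proof -
      have "finite {j. (i # w) @ [j] \<in> dom t}" using that tree unfolding is_tree_def by blast
      then show ?thesis by simp
    qed
    show "w @ [k] \<in> {w. i # w \<in> dom t}"
      if "w @ [j] \<in> {w. i # w \<in> dom t} \<and> 1 \<le> k \<and> k < j" for w j k
    proof -
      have "(i # w) @ [k] \<in> dom t"
        using that tree unfolding is_tree_def by (metis append_Cons mem_Collect_eq)
      then show ?thesis by simp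
    qed
  qed
  moreover have "dom (\<lambda>w. t (i # w)) = {w. i # w \<in> dom t}" by (auto simp: dom_def)
  ultimately show ?thesis using True perm[of "i # _"] by (simp add: PT_def child_def)
qed (simp add: child_def)

lemma child_beyond_arity:
  assumes "t \<in> PT" "i \<notin> {1..arity t}"
  shows "child t i = pt_one"
  using assms in_dom_iff_arity[OF assms(1), of i] by (simp only: child_def if_False)

text \<open>Bisimulation, proved by induction on the address. The relation must hold for all
  \<open>i\<close>, even beyond the arity; the uniform child formulas below make this easier than a
  case split on \<open>i\<close>.\<close>

lemma PT_eqI_coinduct [consumes 1, case_names step]:
  assumes "P t u"
    and step: "\<And>t u. P t u \<Longrightarrow> t \<in> PT \<and> u \<in> PT \<and> root t = root u \<and> arity t = arity u \<and>
      (\<forall>i. P (child t i) (child u i))"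
  shows "t = u"
proof
  show "t w = u w" for w
    using \<open>P t u\<close>
  proof (induction w arbitrary: t u)
    case Nil
    then show ?case using step PT_root_Some by metis
  next
    case (Cons i w)
    with step[OF Cons.prems] PT_Cons[of t i w] PT_Cons[of u i w] show ?case by simp
  qed
qed


section \<open>Product and star on roots, arities and children\<close>

lemma pt_mult_Nil: "t \<in> PT \<Longrightarrow> u \<in> PT \<Longrightarrow> pt_mult t u [] = Some (root t \<circ> root u)"
  by (auto simp: PT_root_Some)

lemma root_pt_mult [simp]: "t \<in> PT \<Longrightarrow> u \<in> PT \<Longrightarrow> root (pt_mult t u) = root t \<circ> root u"
  using pt_mult_Nil by (simp add: root_def)

text \<open>Extends the child formulas of product and star past the arity: the index is fixed there
  and still points to a default child.\<close>

lemma root_beyond_arity: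
  assumes "t \<in> PT" "i \<notin> {1..arity t}"
  shows "root t i = i" "inv_into UNIV (root t) i = i"
  using permutes_not_in[OF PT_root_permutes[OF assms(1)] assms(2)]
    permutes_not_in[OF permutes_inv[OF PT_root_permutes[OF assms(1)]] assms(2)] .

text \<open>The cases of the product merge because \<open>pt_one\<close> has root \<open>id\<close>
  and only \<open>pt_one\<close> as children. If \<open>i\<close> exceeds the arity of
  \<open>u\<close>, then \<open>root u i = i\<close> and \<open>child u i = pt_one\<close>, so the
  product is just \<open>child t i\<close>.\<close>

lemma pt_mult_Cons:
  assumes "t \<in> PT" "u \<in> PT"
  shows "pt_mult t u (i # w) = (if i \<in> {1..max (arity t) (arity u)}
    then pt_mult (child u i) (child t (root u i)) w else None)"
proof (cases "u = pt_one \<or> t = pt_one")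
  case True
  then show ?thesis
    using assms by (auto simp: PT_Cons pt_mult_one_left pt_mult_one_right simp del: pt_mult.simps)
next
  case False
  then show ?thesis
    using assms root_beyond_arity(1)[of u i] child_beyond_arity[of u i]
    by (auto simp: pt_mult_one_left)
qed

lemma pt_mult_in_PT [simp]:
  assumes "t \<in> PT" "u \<in> PT"
  shows "pt_mult t u \<in> PT"
proof -
  \<comment> \<open>The invariant is to be a product of two members of \<open>PT\<close>; by
    \<open>pt_mult_Cons\<close> subtrees of a product are again such products.\<close>
  have "\<exists>t u. t \<in> PT \<and> u \<in> PT \<and> x = pt_mult t u \<Longrightarrow> x \<in> PT" for x
  proof (erule PT_coinduct)
    fix x assume "\<exists>t u. t \<in> PT \<and> u \<in> PT \<and> x = pt_mult t u"
    then obtain t u where tu: "t \<in> PT" "u \<in> PT" "x = pt_mult t u" by blast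
    have "root t permutes {1..max (arity t) (arity u)}"
      "root u permutes {1..max (arity t) (arity u)}"
      by (rule permutes_subset[OF PT_root_permutes], use tu in auto)+
    moreover have "\<exists>t' u'. t' \<in> PT \<and> u' \<in> PT \<and>
      pt_mult (child u i) (child t (root u i)) = pt_mult t' u'" for i
      using tu child_in_PT by blast
    ultimately show "x [] \<noteq> None \<and> (\<exists>n. root x permutes {1..n} \<and>
      (\<forall>i. if i \<in> {1..n} then \<exists>t u. t \<in> PT \<and> u \<in> PT \<and> (\<lambda>w. x (i # w)) = pt_mult t u
           else \<forall>w. x (i # w) = None))"
      using tu
      by (intro conjI exI[of _ "max (arity t) (arity u)"])
        (auto simp: pt_mult_Nil pt_mult_Cons permutes_compose simp del: pt_mult.simps)
  qed
  with assms show ?thesis by blast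
qed

lemma arity_eqI:
  assumes "t \<in> PT" "\<And>i. t [i] \<noteq> None \<longleftrightarrow> i \<in> {1..n}"
  shows "arity t = n"
proof -
  have "{1..arity t} = {1..n}" using assms in_dom_iff_arity[OF assms(1)] by blast
  then show ?thesis by (metis card_atLeastAtMost diff_Suc_1)
qed

lemma arity_pt_mult [simp]:
  assumes "t \<in> PT" "u \<in> PT"
  shows "arity (pt_mult t u) = max (arity t) (arity u)"
  using assms by (intro arity_eqI) (simp_all add: pt_mult_Cons pt_mult_Nil del: pt_mult.simps)

lemma child_pt_mult [simp]:
  assumes "t \<in> PT" "u \<in> PT"
  shows "child (pt_mult t u) i = pt_mult (child u i) (child t (root u i))"
proof (cases "i \<in> {1..max (arity t) (arity u)}")
  case True
  then have "[i] \<in> dom (pt_mult t u)"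
    using assms by (simp only: in_dom_iff_arity pt_mult_in_PT arity_pt_mult)
  then show ?thesis
    using assms True by (simp add: child_def[of "pt_mult t u"] pt_mult_Cons del: pt_mult.simps)
next
  case False
  \<comment> \<open>Beyond both arities \<open>root u\<close> fixes \<open>i\<close>, so both sides
    reduce to \<open>pt_one\<close>.\<close>
  then have "i \<notin> {1..arity t}" "i \<notin> {1..arity u}" by auto
  with False assms show ?thesis
    by (simp add: child_beyond_arity root_beyond_arity pt_mult_one_left del: atLeastAtMost_iff)
qed

lemma inv_root_permutes: "t \<in> PT \<Longrightarrow> inv_into UNIV (root t) permutes {1..arity t}"
  by (rule permutes_inv[OF PT_root_permutes])

lemma pt_star_in_PT [simp]:
  assumes "t \<in> PT"
  shows "pt_star t \<in> PT"
proof -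
  have "\<exists>t. t \<in> PT \<and> x = pt_star t \<Longrightarrow> x \<in> PT" for x
  proof (erule PT_coinduct)
    fix x assume "\<exists>t. t \<in> PT \<and> x = pt_star t"
    then obtain t where t: "t \<in> PT" "x = pt_star t" by blast
    show "x [] \<noteq> None \<and> (\<exists>n. root x permutes {1..n} \<and>
      (\<forall>i. if i \<in> {1..n} then \<exists>t. t \<in> PT \<and> (\<lambda>w. x (i # w)) = pt_star t
           else \<forall>w. x (i # w) = None))"
      using t inv_root_permutes[OF t(1)]
      by (intro conjI exI[of _ "arity t"])
        (auto simp: root_def[of "pt_star t"] intro!: exI[of _ "child t _"])
  qed
  with assms show ?thesis by blast
qed

lemma root_pt_star [simp]: "root (pt_star t) = inv_into UNIV (root t)"
  by (simp add: root_def[of "pt_star t"])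

lemma arity_pt_star [simp]: "t \<in> PT \<Longrightarrow> arity (pt_star t) = arity t"
  by (intro arity_eqI) simp_all

lemma child_pt_star [simp]:
  assumes "t \<in> PT"
  shows "child (pt_star t) i = pt_star (child t (inv_into UNIV (root t) i))"
proof (cases "i \<in> {1..arity t}")
  case True
  then have "[i] \<in> dom (pt_star t)"
    using assms by (simp only: in_dom_iff_arity pt_star_in_PT arity_pt_star)
  then show ?thesis using True by (simp add: child_def[of "pt_star t"])
next
  case False
  with assms show ?thesis
    by (simp add: child_beyond_arity root_beyond_arity pt_star_one del: atLeastAtMost_iff)
qed

lemma bij_root [simp]: "t \<in> PT \<Longrightarrow> bij (root t)"
  using PT_root_permutes permutes_bij by blast

lemma root_inverses [simp]:
  assumes "t \<in> PT"
  shows "root t (inv_into UNIV (root t) i) = i" "inv_into UNIV (root t) (root t i) = i"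
    "root t \<circ> inv_into UNIV (root t) = id" "inv_into UNIV (root t) \<circ> root t = id"
    "inv_into UNIV (inv_into UNIV (root t)) = root t"
  using permutes_inverses[OF PT_root_permutes[OF assms]]
    permutes_inv_o[OF PT_root_permutes[OF assms]] permutes_inv_inv[OF PT_root_permutes[OF assms]]
  by auto


section \<open>The inverse monoid laws\<close>

declare pt_mult.simps [simp del] pt_star.simps [simp del]

text \<open>Passing to children moves the brackets: those of \<open>(t u) v\<close> have the form
  \<open>v' (u' t')\<close>, those of \<open>t (u v)\<close> the form \<open>(v' u') t'\<close>. The
  relation therefore uses unordered pairs, and \<open>child v i\<close> takes the place of
  \<open>t\<close>.\<close>

lemma pt_mult_assoc:
  assumes "t \<in> PT" "u \<in> PT" "v \<in> PT"
  shows "pt_mult (pt_mult t u) v = pt_mult t (pt_mult u v)"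
proof -
  let ?P = "\<lambda>x y. \<exists>t u v. t \<in> PT \<and> u \<in> PT \<and> v \<in> PT \<and>
    {x, y} = {pt_mult (pt_mult t u) v, pt_mult t (pt_mult u v)}"
  have "?P x y \<Longrightarrow> x = y" for x y
  proof (erule PT_eqI_coinduct)
    fix x y assume "?P x y"
    then obtain t u v where "t \<in> PT" "u \<in> PT" "v \<in> PT" and
      "x = pt_mult (pt_mult t u) v \<and> y = pt_mult t (pt_mult u v) \<or>
       y = pt_mult (pt_mult t u) v \<and> x = pt_mult t (pt_mult u v)"
      by (auto simp: doubleton_eq_iff)
    then show "x \<in> PT \<and> y \<in> PT \<and> root x = root y \<and> arity x = arity y \<and>
      (\<forall>i. ?P (child x i) (child y i))"
      by (intro conjI allI exI[of _ "child v _"] exI[of _ "child u (root v _)"]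
          exI[of _ "child t (root u (root v _))"]) (auto simp: comp_assoc)
  qed
  with assms show ?thesis by blast
qed

lemma pt_star_star:
  assumes "t \<in> PT"
  shows "pt_star (pt_star t) = t"
proof -
  let ?P = "\<lambda>x y. y \<in> PT \<and> x = pt_star (pt_star y)"
  have "?P x y \<Longrightarrow> x = y" for x y
    by (erule PT_eqI_coinduct) auto
  with assms show ?thesis by blast
qed

lemma pt_star_mult:
  assumes "t \<in> PT" "u \<in> PT"
  shows "pt_star (pt_mult t u) = pt_mult (pt_star u) (pt_star t)"
proof -
  let ?P = "\<lambda>x y. \<exists>t u. t \<in> PT \<and> u \<in> PT \<and>
    x = pt_star (pt_mult t u) \<and> y = pt_mult (pt_star u) (pt_star t)"
  have "?P x y \<Longrightarrow> x = y" for x y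
  proof (erule PT_eqI_coinduct)
    fix x y assume "?P x y"
    then obtain t u where tu: "t \<in> PT" "u \<in> PT" and
      xy: "x = pt_star (pt_mult t u)" "y = pt_mult (pt_star u) (pt_star t)" by blast
    have "inv_into UNIV (root t \<circ> root u) = inv_into UNIV (root u) \<circ> inv_into UNIV (root t)"
      using tu by (simp add: o_inv_distrib)
    moreover from this have "?P (child x i) (child y i)" for i
      using tu xy
      \<comment> \<open>With \<open>k\<close> the preimage of \<open>i\<close> under
        \<open>root t\<close> and \<open>j\<close> that of \<open>k\<close> under
        \<open>root u\<close>, the children are the star of \<open>u_j t_k\<close> and the product
        of the stars of \<open>t_k\<close> and \<open>u_j\<close>. Hence \<open>u_j\<close> takes
        the role of \<open>t\<close>, and \<open>t_k\<close> that of \<open>u\<close>.\<close>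
      by (intro exI[of _ "child u (inv_into UNIV (root u) (inv_into UNIV (root t) i))"]
          exI[of _ "child t (inv_into UNIV (root t) i)"]) simp
    ultimately show "x \<in> PT \<and> y \<in> PT \<and> root x = root y \<and> arity x = arity y \<and>
      (\<forall>i. ?P (child x i) (child y i))"
      using tu xy by (simp add: max.commute)
  qed
  with assms show ?thesis by blast
qed

text \<open>The root cancels against its inverse, so with \<open>c = child t i\<close> the child at
  \<open>i\<close> is \<open>c (star c c)\<close>; associativity restores the original
  bracketing.\<close>

lemma pt_mult_star_mult:
  assumes "t \<in> PT"
  shows "pt_mult (pt_mult t (pt_star t)) t = t"
proof -
  let ?P = "\<lambda>x y. y \<in> PT \<and> x = pt_mult (pt_mult y (pt_star y)) y"
  have "?P x y \<Longrightarrow> x = y" for x y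
    by (erule PT_eqI_coinduct) (auto simp: pt_mult_assoc)
  with assms show ?thesis by blast
qed

text \<open>\<open>t (star t)\<close> has root \<open>id\<close>, and its child at \<open>i\<close>
  is \<open>(star c) c\<close>, where \<open>c\<close> is the child of \<open>t\<close> at the
  preimage of \<open>i\<close>. This is \<open>s (star s)\<close> for \<open>s = star c\<close>,
  which is why the witnesses are stars.\<close>

lemma pt_mult_star_commute:
  assumes "t \<in> PT" "u \<in> PT"
  shows "pt_mult (pt_mult t (pt_star t)) (pt_mult u (pt_star u)) =
    pt_mult (pt_mult u (pt_star u)) (pt_mult t (pt_star t))"
proof -
  let ?P = "\<lambda>x y. \<exists>t u. t \<in> PT \<and> u \<in> PT \<and>
    x = pt_mult (pt_mult t (pt_star t)) (pt_mult u (pt_star u)) \<and>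
    y = pt_mult (pt_mult u (pt_star u)) (pt_mult t (pt_star t))"
  have "?P x y \<Longrightarrow> x = y" for x y
  proof (erule PT_eqI_coinduct)
    fix x y assume "?P x y"
    then obtain t u where tu: "t \<in> PT" "u \<in> PT" and
      xy: "x = pt_mult (pt_mult t (pt_star t)) (pt_mult u (pt_star u))"
        "y = pt_mult (pt_mult u (pt_star u)) (pt_mult t (pt_star t))" by blast
    have "?P (child x i) (child y i)" for i
      using tu xy
      by (intro exI[of _ "pt_star (child u (inv_into UNIV (root u) i))"]
          exI[of _ "pt_star (child t (inv_into UNIV (root t) i))"]) (auto simp: pt_star_star)
    then show "x \<in> PT \<and> y \<in> PT \<and> root x = root y \<and> arity x = arity y \<and>
      (\<forall>i. ?P (child x i) (child y i))"
      using tu xy by (auto simp: max.commute)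
  qed
  with assms show ?thesis by blast
qed


section \<open>Idempotents and E-unitarity\<close>

lemma root_cancel:
  assumes "t \<in> PT" "u \<in> PT"
  shows "root t \<circ> root u = root t \<Longrightarrow> root u = id" "root u \<circ> root t = root t \<Longrightarrow> root u = id"
proof -
  show "root u = id" if "root t \<circ> root u = root t"
    using arg_cong[OF that, of "\<lambda>f. inv_into UNIV (root t) \<circ> f"] assms(1)
    by (simp flip: comp_assoc)
  show "root u = id" if "root u \<circ> root t = root t"
    using arg_cong[OF that, of "\<lambda>f. f \<circ> inv_into UNIV (root t)"] assms(1)
    by (simp add: comp_assoc)
qed

lemma root_idempotent:
  assumes "e \<in> PT" "pt_mult e e = e"
  shows "root e = id"
  using assms root_cancel(1)[of e e] root_pt_mult[of e e] by simp

lemma child_idempotent: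
  assumes "e \<in> PT" "pt_mult e e = e"
  shows "pt_mult (child e i) (child e i) = child e i"
  using assms child_pt_mult[of e e i] root_idempotent[of e] by simp

text \<open>An idempotent has root \<open>id\<close> and idempotent children, so star neither
  changes a label nor moves a child. This reduces the natural order below \<open>v\<close> to
  \<open>e v = e\<close>.\<close>

lemma pt_star_idempotent:
  assumes "e \<in> PT" "pt_mult e e = e"
  shows "pt_star e = e"
proof -
  let ?P = "\<lambda>x y. y \<in> PT \<and> pt_mult y y = y \<and> x = pt_star y"
  have "?P x y \<Longrightarrow> x = y" for x y
    by (erule PT_eqI_coinduct) (auto simp: root_idempotent child_idempotent)
  with assms show ?thesis by blast
qed

text \<open>Once \<open>root v = id\<close>, the children of \<open>v v\<close> are the squares of
  the children of \<open>v\<close>. Since \<open>e v = e\<close> yields \<open>v_i e_i = e_i\<close>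
  for the children, and vice versa, the invariant allows either side.\<close>

lemma idempotent_above_idempotent:
  assumes "e \<in> PT" "v \<in> PT" "pt_mult e e = e" "pt_mult e v = e"
  shows "pt_mult v v = v"
proof -
  let ?P = "\<lambda>x v. v \<in> PT \<and> x = pt_mult v v \<and>
    (\<exists>e. e \<in> PT \<and> pt_mult e e = e \<and> (pt_mult e v = e \<or> pt_mult v e = e))"
  have "?P x v \<Longrightarrow> x = v" for x v
  proof (erule PT_eqI_coinduct)
    fix x v assume "?P x v"
    then obtain e where v: "v \<in> PT" "x = pt_mult v v" and e: "e \<in> PT" "pt_mult e e = e"
      and ev: "pt_mult e v = e \<or> pt_mult v e = e" by blast
    \<comment> \<open>On roots, either alternative lets \<open>root e\<close> be cancelled in the
      group of permutations.\<close>
    have rv: "root v = id"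
      using ev root_pt_mult[OF e(1) v(1)] root_pt_mult[OF v(1) e(1)] root_cancel[OF e(1) v(1)]
      by auto
    have "pt_mult (child e i) (child v i) = child e i \<or> pt_mult (child v i) (child e i) = child e i"
      for i
      using ev child_pt_mult[OF e(1) v(1), of i] child_pt_mult[OF v(1) e(1), of i] rv
        root_idempotent[OF e] by auto
    moreover have "child e i \<in> PT \<and> pt_mult (child e i) (child e i) = child e i" for i
      using e child_idempotent by simp
    ultimately have "\<exists>e. e \<in> PT \<and> pt_mult e e = e \<and>
        (pt_mult e (child v i) = e \<or> pt_mult (child v i) e = e)" for i
      by blast
    then show "x \<in> PT \<and> v \<in> PT \<and> root x = root v \<and> arity x = arity v \<and>
      (\<forall>i. ?P (child x i) (child v i))"
      using v rv by simp
  qed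
  with assms show ?thesis by blast
qed

lemma inverse_monoid_PT: "inverse_monoid PT_monoid pt_star"
proof -
  have "monoid PT_monoid"
    by (rule monoidI)
      (simp_all add: PT_monoid_def pt_mult_assoc pt_mult_one_left pt_mult_one_right)
  then show ?thesis
    by (auto intro!: inverse_monoid.intro inverse_monoid_axioms.intro pt_mult_star_commute
        simp: PT_monoid_def pt_star_star pt_star_mult pt_mult_star_mult)
qed

theorem theorem3p6: "E_unitary_inverse_monoid PT_monoid pt_star"
proof -
  interpret inverse_monoid PT_monoid pt_star by (rule inverse_monoid_PT)
  show ?thesis
  proof
    fix e v
    assume "e \<in> carrier PT_monoid" "v \<in> carrier PT_monoid" "idempotent e" "natural_le e v"
    \<comment> \<open>As \<open>star e = e\<close> and \<open>e e = e\<close>, the relation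
      \<open>natural_le e v\<close> says \<open>e v = e\<close>.\<close>
    then show "idempotent v"
      using idempotent_above_idempotent[of e v] pt_star_idempotent[of e]
      unfolding idempotent_def natural_le_def by (simp add: PT_monoid_def)
  qed
qed

end
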